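(* Let $V$ be a finite set with $|V|>1$, let $(\mathsf Z_i : i\in V)$ be discrete random variables with entropy function $H$. For every real $\alpha\ge R_{\mathrm{ACO}}(V)$, the Dilworth truncation $\hat f^{\#}_{\alpha}$ is a polymatroid rank function and $$B(\hat f^{\#}_{\alpha},\le)=B(f^{\#}_{\alpha},\le)=\{\mathbf r_V\in\mathscr R_{\mathrm{CO}}(V): r(V)=\alpha\}\neq\emptyset .$$
   Context: For $X\subseteq V$, $H(X)$ denotes the (finite) Shannon entropy of $(\mathsf Z_i: i\in X)$, $H(\emptyset)=0$, $H(X|Y)=H(X\cup Y)-H(Y)$. For $\mathbf r_V=(r_i:i\in V)\in\mathbb R^{|V|}$, $r(X)=\sum_{i\in X}r_i$, $r(\emptyset)=0$. $\mathscr R_{\mathrm{CO}}(V)=\{\mathbf r_V\in\mathbb R^{|V|}: r(X)\ge H(X|V\setminus X)\ \forall X\subsetneq V\}$ and $R_{\mathrm{ACO}}(V)=\min\{r(V):\mathbf r_V\in\mathscr R_{\mathrm{CO}}(V)\}$. For $\alpha\in\mathbb R_+$: $f_\alpha(X)=H(X|V\setminus X)$ for $X\subsetneq V$, $f_\alpha(V)=\alpha$, and $f^{\#}_\alpha(X)=\alpha-f_\alpha(V\setminus X)$ for $X\subseteq V$ (so $f^{\#}_\alpha(\emptyset)=0$ and $f^{\#}_\alpha(X)=\alpha-H(V)+H(X)$ for $X\ne\emptyset$). $\Pi(X)$ is the set of partitions of $X$ into nonempty disjoint subsets; $f^{\#}_\alpha[\mathcal P]=\sum_{C\in\mathcal P}f^{\#}_\alpha(C)$;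 the Dilworth truncation is $\hat f^{\#}_\alpha(X)=\min_{\mathcal P\in\Pi(X)}f^{\#}_\alpha[\mathcal P]$ for $X\subseteq V$, with $\hat f^{\#}_\alpha(\emptyset)=0$. For $f:2^V\to\mathbb R$: $P(f,\le)=\{\mathbf r_V\in\mathbb R^{|V|}: r(X)\le f(X)\ \forall X\subseteq V\}$ and $B(f,\le)=\{\mathbf r_V\in P(f,\le): r(V)=f(V)\}$. $f$ is a polymatroid rank function if $f(\emptyset)=0$, $f(Y)\le f(X)$ whenever $Y\subseteq X\subseteq V$, and $f(X)+f(Y)\ge f(X\cap Y)+f(X\cup Y)$ for all $X,Y\subseteq V$. *)

theory Defs
  imports "HOL-Probability.Probability" "HOL-Library.Disjoint_Sets" "HOL-Library.FuncSet"
begin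

definition joint :: "('i \<Rightarrow> 'a \<Rightarrow> 'b) \<Rightarrow> 'i set \<Rightarrow> 'a \<Rightarrow> ('i \<Rightarrow> 'b)" where
  "joint Z X = (\<lambda>\<omega>. \<lambda>i\<in>X. Z i \<omega>)"

definition discrete_rv :: "'a measure \<Rightarrow> ('a \<Rightarrow> 'b) \<Rightarrow> bool" where
  "discrete_rv M Y \<longleftrightarrow> Y \<in> measurable M (count_space UNIV) \<and> countable (Y ` space M)"

text \<open>
  The library's entropy is a Bochner integral and hence has the junk value 0 when the sum of
  \<open>- p log p\<close> diverges, so finiteness is a condition of its own.
\<close>

context information_space
begin

definition joint_entropy :: "('i \<Rightarrow> 'a \<Rightarrow> 'b) \<Rightarrow> 'i set \<Rightarrow> real" where
  "joint_entropy Z X = \<H>(joint Z X)"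

definition has_finite_entropy :: "('a \<Rightarrow> 'b) \<Rightarrow> bool" where
  "has_finite_entropy Y \<longleftrightarrow> (\<exists>p. finite_entropy (count_space (Y ` space M)) Y p)"

lemma joint_entropy_empty:
  fixes Z :: "'i \<Rightarrow> 'a \<Rightarrow> 'c"
  shows "joint_entropy Z {} = 0"
proof -
  define c :: "'i \<Rightarrow> 'c" where "c = (\<lambda>_. undefined)"
  have J: "joint Z {} = (\<lambda>_. c)"
    by (simp add: joint_def c_def restrict_def fun_eq_iff)
  have img: "(\<lambda>_. c) ` space M = {c}"
    using not_empty by auto
  have "simple_distributed M (\<lambda>_. c) (\<lambda>_. 1)"
    by (rule simple_distributedI) (auto simp: prob_space)
  then show ?thesis
    unfolding joint_entropy_def J
    by (subst entropy_simple_distributed) (auto simp: img)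
qed

end

definition cond_ent :: "('i set \<Rightarrow> real) \<Rightarrow> 'i set \<Rightarrow> 'i set \<Rightarrow> real" where
  "cond_ent H X Y = H (X \<union> Y) - H Y"

text \<open>
  Vectors in \<open>\<real>\<^sup>V\<close> are functions in \<open>extensional V\<close>; \<open>r(X)\<close> is \<open>sum r X\<close>.
\<close>

definition R_CO :: "'i set \<Rightarrow> ('i set \<Rightarrow> real) \<Rightarrow> ('i \<Rightarrow> real) set" where
  "R_CO V H = {r \<in> extensional V. \<forall>X. X \<subset> V \<longrightarrow> sum r X \<ge> cond_ent H X (V - X)}"

text \<open>A minimum over an infinite set of reals, hence \<open>LEAST\<close> rather than \<open>Min\<close>.\<close>

definition R_ACO :: "'i set \<Rightarrow> ('i set \<Rightarrow> real) \<Rightarrow> real" where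
  "R_ACO V H = (LEAST x. x \<in> (\<lambda>r. sum r V) ` R_CO V H)"

definition f_rate :: "'i set \<Rightarrow> ('i set \<Rightarrow> real) \<Rightarrow> real \<Rightarrow> 'i set \<Rightarrow> real" where
  "f_rate V H \<alpha> X = (if X = V then \<alpha> else cond_ent H X (V - X))"

definition f_sharp :: "'i set \<Rightarrow> ('i set \<Rightarrow> real) \<Rightarrow> real \<Rightarrow> 'i set \<Rightarrow> real" where
  "f_sharp V H \<alpha> X = \<alpha> - f_rate V H \<alpha> (V - X)"

text \<open>The only partition of \<open>{}\<close> is \<open>{}\<close>, so the truncation vanishes at the empty set.\<close>

definition dilworth :: "('i set \<Rightarrow> real) \<Rightarrow> 'i set \<Rightarrow> real" where
  "dilworth f X = Min ((\<lambda>P. \<Sum>C\<in>P. f C) ` {P. partition_on X P})"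

definition sub_polyhedron :: "'i set \<Rightarrow> ('i set \<Rightarrow> real) \<Rightarrow> ('i \<Rightarrow> real) set" where
  "sub_polyhedron V f = {r \<in> extensional V. \<forall>X. X \<subseteq> V \<longrightarrow> sum r X \<le> f X}"

definition base_polyhedron :: "'i set \<Rightarrow> ('i set \<Rightarrow> real) \<Rightarrow> ('i \<Rightarrow> real) set" where
  "base_polyhedron V f = {r \<in> sub_polyhedron V f. sum r V = f V}"

definition polymatroid_rank :: "'i set \<Rightarrow> ('i set \<Rightarrow> real) \<Rightarrow> bool" where
  "polymatroid_rank V f \<longleftrightarrow>
     f {} = 0 \<and>
     (\<forall>X Y. Y \<subseteq> X \<and> X \<subseteq> V \<longrightarrow> f Y \<le> f X) \<and>
     (\<forall>X Y. X \<subseteq> V \<and> Y \<subseteq> V \<longrightarrow> f X + f Y \<ge> f (X \<inter> Y) + f (X \<union> Y))"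

end

theory Submission
  imports Defs
begin

text \<open>
  Entropy is a polymatroid rank function, so \<open>f\<^sup>#\<close> is submodular on intersecting pairs.
  Its Dilworth truncation is then submodular: write the two sets as unions of the blocks of
  optimal partitions and add the blocks of one partition to the other set one at a time; no
  uncrossing of a laminar family is needed. For \<open>\<alpha> \<ge> R\<^sub>A\<^sub>C\<^sub>O\<close>, raising one coordinate of an
  optimal rate vector (which exists by compactness) gives a point \<open>r\<close> of the rate region with
  \<open>r(V) = \<alpha>\<close>. Such a point is nonnegative because \<open>|V| > 1\<close>, and complementation puts it below
  \<open>f\<^sup>#\<close>. Hence \<open>f\<^sup># \<ge> 0\<close>, which makes the truncation monotone, and the truncation has the value
  \<open>\<alpha>\<close> at \<open>V\<close>, which makes the base polyhedra equal.
\<close>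

section \<open>Entropy is a polymatroid rank function\<close>

context information_space
begin

section \<open>Mass functions, and entropy as an expectation\<close>

text \<open>A density is determined only almost everywhere, but under counting measure every point
  is an atom, so integrating over \<open>{t}\<close> recovers the value itself.\<close>

lemma finite_entropy_count_space_density:
  assumes f: "finite_entropy (count_space (T ` space M)) T f" and t: "t \<in> T ` space M"
  shows "f t = measure M (T -` {t} \<inter> space M)"
proof -
  note D = finite_entropy_distributed[OF f]
  have "emeasure M (T -` {t} \<inter> space M) = (\<integral>\<^sup>+x. ennreal (f x) * indicator {t} x \<partial>count_space (T ` space M))"
    using t by (intro distributed_emeasure[OF D]) auto
  also have "\<dots> = f t"
    using t by (subst nn_integral_count_space'[where A="{t}"]) (auto simp: indicator_def)
  finally show ?thesis
    using finite_entropy_nn[OF f] t by (simp add: measure_def)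
qed

text \<open>Values of density zero are hit with probability zero. This keeps the later estimates
  away from the logarithm of 0.\<close>

lemma finite_entropy_AE_pos:
  assumes f: "finite_entropy (count_space (T ` space M)) T f"
  shows "AE \<omega> in M. 0 < f (T \<omega>)"
  by (subst distributed_AE2[OF finite_entropy_distributed[OF f]]) auto

text \<open>Moving the sum from the range of \<open>T\<close> to \<open>M\<close> puts the entropies
  of variables with different ranges under integrals over one space, where they can be compared
  pointwise.\<close>

lemma entropy_eq_expectation_log_density:
  assumes f: "finite_entropy (count_space (T ` space M)) T f"
  shows "\<H>(T) = - (\<integral>\<omega>. log b (f (T \<omega>)) \<partial>M)"
    and "integrable M (\<lambda>\<omega>. log b (f (T \<omega>)))"
proof -
  note D = finite_entropy_distributed[OF f]
  note nn = finite_entropy_nn[OF f]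
  have "(\<integral>x. f x * log b (f x) \<partial>count_space (T ` space M)) = (\<integral>\<omega>. log b (f (T \<omega>)) \<partial>M)"
    by (rule distributed_integral[OF D]) (use nn in auto)
  then show "\<H>(T) = - (\<integral>\<omega>. log b (f (T \<omega>)) \<partial>M)"
    using entropy_distr[OF D nn] by simp
  show "integrable M (\<lambda>\<omega>. log b (f (T \<omega>)))"
    by (rule distributed_integrable[OF D, THEN iffD1])
       (use nn finite_entropy_integrable[OF f] in auto)
qed

text \<open>The fibre of \<open>X\<close> through an outcome lies in the fibre of \<open>Y\<close>,
  so \<open>Y\<close> has the larger mass there; take logarithms and expectations.\<close>

lemma entropy_function_le:
  assumes X: "has_finite_entropy X" and Y: "has_finite_entropy Y"
    and YX: "\<And>\<omega>. Y \<omega> = g (X \<omega>)"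
  shows "\<H>(Y) \<le> \<H>(X)"
proof -
  obtain p where p: "finite_entropy (count_space (X ` space M)) X p"
    using X unfolding has_finite_entropy_def by blast
  obtain q where q: "finite_entropy (count_space (Y ` space M)) Y q"
    using Y unfolding has_finite_entropy_def by blast
  have le: "p (X \<omega>) \<le> q (Y \<omega>)" if "\<omega> \<in> space M" for \<omega>
  proof -
    have "p (X \<omega>) = measure M (X -` {X \<omega>} \<inter> space M)"
      using that by (intro finite_entropy_count_space_density[OF p]) auto
    also have "\<dots> \<le> measure M (Y -` {Y \<omega>} \<inter> space M)"
    proof (rule finite_measure_mono)
      show "X -` {X \<omega>} \<inter> space M \<subseteq> Y -` {Y \<omega>} \<inter> space M"
        by (auto simp: YX)
      show "Y -` {Y \<omega>} \<inter> space M \<in> sets M"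
        using that distributed_measurable[OF finite_entropy_distributed[OF q]]
        by (auto intro: measurable_sets)
    qed
    also have "\<dots> = q (Y \<omega>)"
      using that by (intro finite_entropy_count_space_density[OF q, symmetric]) auto
    finally show ?thesis .
  qed
  have "(\<integral>\<omega>. log b (p (X \<omega>)) \<partial>M) \<le> (\<integral>\<omega>. log b (q (Y \<omega>)) \<partial>M)"
  proof (rule integral_mono_AE)
    show "AE \<omega> in M. log b (p (X \<omega>)) \<le> log b (q (Y \<omega>))"
      using finite_entropy_AE_pos[OF p] AE_space
    proof eventually_elim
      case (elim \<omega>)
      then show ?case using le[of \<omega>] b_gt_1 by simp
    qed
  qed (use entropy_eq_expectation_log_density(2) p q in auto)
  then show ?thesis
    using entropy_eq_expectation_log_density(1)[OF p] entropy_eq_expectation_log_density(1)[OF q]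
    by simp
qed

text \<open>
  With \<open>t = p(X) q(Y) / (a(A) w(U))\<close>, the claim is that \<open>log t\<close> has nonpositive expectation. This
  follows from \<open>ln t \<le> t - 1\<close> once \<open>t\<close> has expectation at most 1, which is shown by summing
  \<open>p r * q s / a (g r)\<close> over all \<open>(r, s)\<close> with \<open>g r = h s\<close>.
\<close>

lemma entropy_submodular:
  fixes X :: "'a \<Rightarrow> 'x" and Y :: "'a \<Rightarrow> 'y" and A :: "'a \<Rightarrow> 'c" and U :: "'a \<Rightarrow> 'u"
  assumes X: "has_finite_entropy X" and Y: "has_finite_entropy Y"
    and A: "has_finite_entropy A" and U: "has_finite_entropy U"
    and XU: "\<And>\<omega>. X \<omega> = x (U \<omega>)" and YU: "\<And>\<omega>. Y \<omega> = y (U \<omega>)"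
    and inj: "inj_on (\<lambda>u. (x u, y u)) (U ` space M)"
    and AX: "\<And>\<omega>. A \<omega> = g (X \<omega>)" and AY: "\<And>\<omega>. A \<omega> = h (Y \<omega>)"
  shows "\<H>(A) + \<H>(U) \<le> \<H>(X) + \<H>(Y)"
proof -
  obtain p where p: "finite_entropy (count_space (X ` space M)) X p"
    using X unfolding has_finite_entropy_def by blast
  obtain q where q: "finite_entropy (count_space (Y ` space M)) Y q"
    using Y unfolding has_finite_entropy_def by blast
  obtain a where a: "finite_entropy (count_space (A ` space M)) A a"
    using A unfolding has_finite_entropy_def by blast
  obtain w where w: "finite_entropy (count_space (U ` space M)) U w"
    using U unfolding has_finite_entropy_def by blast
  note Dp = finite_entropy_distributed[OF p] and Dq = finite_entropy_distributed[OF q]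
    and Da = finite_entropy_distributed[OF a] and Dw = finite_entropy_distributed[OF w]
  have nn: "\<omega> \<in> space M \<Longrightarrow> 0 \<le> p (X \<omega>)" "\<omega> \<in> space M \<Longrightarrow> 0 \<le> q (Y \<omega>)"
    "\<omega> \<in> space M \<Longrightarrow> 0 \<le> a (A \<omega>)" "\<omega> \<in> space M \<Longrightarrow> 0 \<le> w (U \<omega>)" for \<omega>
    using finite_entropy_nn[OF p] finite_entropy_nn[OF q] finite_entropy_nn[OF a]
      finite_entropy_nn[OF w] by auto
  have [measurable]: "(\<lambda>\<omega>. p (X \<omega>)) \<in> borel_measurable M" "(\<lambda>\<omega>. q (Y \<omega>)) \<in> borel_measurable M"
    "(\<lambda>\<omega>. a (A \<omega>)) \<in> borel_measurable M" "(\<lambda>\<omega>. w (U \<omega>)) \<in> borel_measurable M"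
    using measurable_compose[OF distributed_measurable[OF Dp], of p borel]
      measurable_compose[OF distributed_measurable[OF Dq], of q borel]
      measurable_compose[OF distributed_measurable[OF Da], of a borel]
      measurable_compose[OF distributed_measurable[OF Dw], of w borel] by auto
  define t where "t = (\<lambda>\<omega>. p (X \<omega>) * q (Y \<omega>) / (a (A \<omega>) * w (U \<omega>)))"
  have [measurable]: "t \<in> borel_measurable M"
    unfolding t_def by measurable
  have t_nn: "0 \<le> t \<omega>" if "\<omega> \<in> space M" for \<omega>
    using nn that by (simp add: t_def)
  define F where "F = (\<lambda>(r, s). ennreal (p r * q s / a (g r))
    * indicator {(r, s). r \<in> X ` space M \<and> s \<in> Y ` space M \<and> g r = h s} (r, s))"
  \<comment> \<open>For fixed \<open>r\<close>, the values \<open>q s\<close> with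
    \<open>h s = g r\<close> add up to the probability that \<open>A\<close> equals
    \<open>g r\<close>, which is \<open>a (g r)\<close> and cancels the denominator. Only an
    inequality is claimed: if \<open>a (g r) = 0\<close>, division by zero makes the left side
    0.\<close>
  have inner: "(\<integral>\<^sup>+s. F (r, s) \<partial>count_space UNIV) \<le> ennreal (p r) * indicator (X ` space M) r" for r
  proof (cases "r \<in> X ` space M")
    case True
    then obtain \<omega>0 where \<omega>0: "\<omega>0 \<in> space M" "r = X \<omega>0" by auto
    have ar: "a (g r) = measure M (A -` {g r} \<inter> space M)"
      using \<omega>0 by (intro finite_entropy_count_space_density[OF a]) (auto simp: AX)
    have "(\<integral>\<^sup>+s. F (r, s) \<partial>count_space UNIV)
        = (\<integral>\<^sup>+s. F (r, s) * indicator (Y ` space M) s \<partial>count_space UNIV)"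
      by (intro nn_integral_cong) (auto simp: F_def indicator_def)
    also have "\<dots> = (\<integral>\<^sup>+s. F (r, s) \<partial>count_space (Y ` space M))"
      by (simp add: nn_integral_count_space_indicator)
    also have "\<dots> = (\<integral>\<^sup>+s. ennreal (p r / a (g r)) * (ennreal (q s) * indicator {s. h s = g r} s)
        \<partial>count_space (Y ` space M))"
      using True nn \<omega>0 ar
      by (intro nn_integral_cong)
         (auto simp: F_def indicator_def ennreal_mult'[symmetric] AX)
    also have "\<dots> = ennreal (p r / a (g r)) *
        (\<integral>\<^sup>+s. ennreal (q s) * indicator {s. h s = g r} s \<partial>count_space (Y ` space M))"
      by (rule nn_integral_cmult) simp
    also have "(\<integral>\<^sup>+s. ennreal (q s) * indicator {s. h s = g r} s \<partial>count_space (Y ` space M))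
        = (\<integral>\<^sup>+\<omega>. indicator {s. h s = g r} (Y \<omega>) \<partial>M)"
      by (rule distributed_nn_integral[OF Dq]) simp
    also have "\<dots> = (\<integral>\<^sup>+\<omega>. indicator (A -` {g r} \<inter> space M) \<omega> \<partial>M)"
      by (intro nn_integral_cong) (auto simp: indicator_def AY)
    also have "\<dots> = emeasure M (A -` {g r} \<inter> space M)"
      using \<omega>0 distributed_measurable[OF Da]
      by (intro nn_integral_indicator) (auto intro!: measurable_sets simp: AX)
    also have "\<dots> = ennreal (a (g r))"
      by (simp add: ar emeasure_eq_measure)
    also have "ennreal (p r / a (g r)) * ennreal (a (g r)) \<le> ennreal (p r)"
      using nn \<omega>0 ar by (simp add: ennreal_mult'[symmetric] ennreal_leI)
    finally show ?thesis
      using True by simp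
  qed (auto simp: F_def)
  have "(\<integral>\<^sup>+\<omega>. ennreal (t \<omega>) \<partial>M)
      = (\<integral>\<^sup>+\<omega>. ennreal (p (x (U \<omega>)) * q (y (U \<omega>)) / (a (g (x (U \<omega>))) * w (U \<omega>))) \<partial>M)"
    by (simp add: t_def XU YU AX)
  also have "\<dots> = (\<integral>\<^sup>+u. ennreal (w u) * ennreal (p (x u) * q (y u) / (a (g (x u)) * w u))
      \<partial>count_space (U ` space M))"
    by (rule distributed_nn_integral[OF Dw, symmetric]) simp
  also have "\<dots> \<le> (\<integral>\<^sup>+u. F (x u, y u) \<partial>count_space (U ` space M))"
  proof (rule nn_integral_mono)
    fix u assume "u \<in> space (count_space (U ` space M))"
    then obtain \<omega> where \<omega>: "\<omega> \<in> space M" "u = U \<omega>" by auto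
    have eq: "x u = X \<omega>" "y u = Y \<omega>" "g (x u) = A \<omega>" "h (y u) = A \<omega>"
      using \<omega> by (simp_all add: XU YU AX) (simp add: XU[symmetric] YU[symmetric] AX[symmetric] AY[symmetric])
    \<comment> \<open>The factor \<open>w u\<close> cancels when it is nonzero; otherwise the left
      side is 0 and the right side is nonnegative.\<close>
    have "w u * (p (x u) * q (y u) / (a (g (x u)) * w u)) \<le> p (x u) * q (y u) / a (g (x u))"
      using nn[OF \<omega>(1)] unfolding eq by (simp add: AX)
    then show "ennreal (w u) * ennreal (p (x u) * q (y u) / (a (g (x u)) * w u)) \<le> F (x u, y u)"
      using nn[OF \<omega>(1)] \<omega> eq by (simp add: F_def ennreal_mult'[symmetric] ennreal_leI)
  qed
  \<comment> \<open>By \<open>inj\<close>, summing over \<open>u\<close> is summing over the pairs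
    \<open>(x u, y u)\<close>; admitting all pairs then only adds nonnegative terms.\<close>
  also have "\<dots> = (\<integral>\<^sup>+z. F z \<partial>count_space ((\<lambda>u. (x u, y u)) ` U ` space M))"
    using inj by (intro nn_integral_bij_count_space) (auto simp: bij_betw_def)
  also have "\<dots> = (\<integral>\<^sup>+z. F z * indicator ((\<lambda>u. (x u, y u)) ` U ` space M) z \<partial>count_space UNIV)"
    by (rule nn_integral_count_space_indicator) simp
  also have "\<dots> \<le> (\<integral>\<^sup>+z. F z \<partial>count_space UNIV)"
    by (intro nn_integral_mono) (auto simp: indicator_def)
  also have "\<dots> = (\<integral>\<^sup>+r. \<integral>\<^sup>+s. F (r, s) \<partial>count_space UNIV \<partial>count_space UNIV)"
    by (rule nn_integral_fst_count_space[symmetric])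
  also have "\<dots> \<le> (\<integral>\<^sup>+r. ennreal (p r) * indicator (X ` space M) r \<partial>count_space UNIV)"
    by (intro nn_integral_mono inner)
  also have "\<dots> = (\<integral>\<^sup>+r. ennreal (p r) * 1 \<partial>count_space (X ` space M))"
    by (simp add: nn_integral_count_space_indicator)
  also have "\<dots> = (\<integral>\<^sup>+\<omega>. 1 \<partial>M)"
    by (rule distributed_nn_integral[OF Dp]) simp
  also have "\<dots> = 1"
    by (simp add: emeasure_space_1)
  finally have t_le: "(\<integral>\<^sup>+\<omega>. ennreal (t \<omega>) \<partial>M) \<le> 1" .
  have t_int: "integrable M t"
    using t_nn t_le by (intro integrableI_nonneg) (auto intro: le_less_trans simp: AE_I2)
  have "(\<integral>\<omega>. t \<omega> \<partial>M) \<le> 1"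
    using t_le t_nn by (subst integral_eq_nn_integral) (auto simp: AE_I2 enn2real_leI)
  note int = entropy_eq_expectation_log_density(2)[OF p] entropy_eq_expectation_log_density(2)[OF q]
    entropy_eq_expectation_log_density(2)[OF a] entropy_eq_expectation_log_density(2)[OF w]
  have "\<H>(A) + \<H>(U) - \<H>(X) - \<H>(Y)
    = (\<integral>\<omega>. log b (p (X \<omega>)) + log b (q (Y \<omega>)) - log b (a (A \<omega>)) - log b (w (U \<omega>)) \<partial>M)"
    using int entropy_eq_expectation_log_density(1)[OF p] entropy_eq_expectation_log_density(1)[OF q]
      entropy_eq_expectation_log_density(1)[OF a] entropy_eq_expectation_log_density(1)[OF w]
    by simp
  also have "\<dots> \<le> (\<integral>\<omega>. (t \<omega> - 1) / ln b \<partial>M)"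
  proof (rule integral_mono_AE)
    show "AE \<omega> in M. log b (p (X \<omega>)) + log b (q (Y \<omega>)) - log b (a (A \<omega>)) - log b (w (U \<omega>))
        \<le> (t \<omega> - 1) / ln b"
      using finite_entropy_AE_pos[OF p] finite_entropy_AE_pos[OF q] finite_entropy_AE_pos[OF a]
        finite_entropy_AE_pos[OF w]
    proof eventually_elim
      case (elim \<omega>)
      then have "0 < t \<omega>" by (simp add: t_def)
      have "log b (p (X \<omega>)) + log b (q (Y \<omega>)) - log b (a (A \<omega>)) - log b (w (U \<omega>)) = ln (t \<omega>) / ln b"
        using elim by (simp add: t_def log_def ln_mult ln_div add_divide_distrib diff_divide_distrib)
      also have "\<dots> \<le> (t \<omega> - 1) / ln b"
        using ln_le_minus_one[OF \<open>0 < t \<omega>\<close>] b_gt_1 by (intro divide_right_mono) auto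
      finally show ?case .
    qed
  qed (use int t_int in auto)
  also have "\<dots> = ((\<integral>\<omega>. t \<omega> \<partial>M) - 1) / ln b"
    using t_int by (simp add: prob_space)
  also have "\<dots> \<le> 0"
    using \<open>(\<integral>\<omega>. t \<omega> \<partial>M) \<le> 1\<close> b_gt_1 by (simp add: divide_le_0_iff)
  finally show ?thesis by simp
qed

section \<open>Joint entropy as a set function\<close>

lemma joint_restrict: "Y \<subseteq> X \<Longrightarrow> joint Z Y \<omega> = restrict (joint Z X \<omega>) Y"
  by (auto simp: joint_def fun_eq_iff restrict_def)

text \<open>A subfamily is a restriction of the larger family, hence a function of it. Conversely,
  the family on \<open>X \<union> Y\<close> is recovered from its restrictions to \<open>X\<close>
  and \<open>Y\<close>, which is the injectivity that submodularity asks for.\<close>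

lemma polymatroid_rank_joint_entropy:
  assumes fin: "\<And>X. X \<subseteq> V \<Longrightarrow> has_finite_entropy (joint Z X)"
  shows "polymatroid_rank V (joint_entropy Z)"
  unfolding polymatroid_rank_def
proof (intro conjI allI impI)
  show "joint_entropy Z {} = 0" by (rule joint_entropy_empty)
next
  fix X Y assume XY: "Y \<subseteq> X \<and> X \<subseteq> V"
  then show "joint_entropy Z Y \<le> joint_entropy Z X"
    unfolding joint_entropy_def
    by (intro entropy_function_le[where g="\<lambda>f. restrict f Y"] fin) (auto simp: joint_restrict)
next
  fix X Y assume XY: "X \<subseteq> V \<and> Y \<subseteq> V"
  have inj: "inj_on (\<lambda>u. (restrict u X, restrict u Y)) (joint Z (X \<union> Y) ` space M)"
  proof (rule inj_onI)
    fix u v assume uv: "u \<in> joint Z (X \<union> Y) ` space M" "v \<in> joint Z (X \<union> Y) ` space M"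
      "(restrict u X, restrict u Y) = (restrict v X, restrict v Y)"
    then have ext: "u \<in> extensional (X \<union> Y)" "v \<in> extensional (X \<union> Y)"
      by (auto simp: joint_def)
    have "restrict u X i = restrict v X i" "restrict u Y i = restrict v Y i" for i
      using uv(3) by auto
    then show "u = v"
      using ext by (intro extensionalityI[OF ext]) (metis UnE restrict_apply')
  qed
  have "joint_entropy Z (X \<inter> Y) + joint_entropy Z (X \<union> Y) \<le> joint_entropy Z X + joint_entropy Z Y"
    unfolding joint_entropy_def
    using XY inj
    by (intro entropy_submodular[where x="\<lambda>f. restrict f X" and y="\<lambda>f. restrict f Y"
          and g="\<lambda>f. restrict f (X \<inter> Y)" and h="\<lambda>f. restrict f (X \<inter> Y)"] fin)
       (auto intro!: joint_restrict)
  then show "joint_entropy Z X + joint_entropy Z Y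
      \<ge> joint_entropy Z (X \<inter> Y) + joint_entropy Z (X \<union> Y)" .
qed

end

section \<open>Dilworth truncation\<close>

lemma dilworth_le:
  assumes "finite X" "partition_on X P"
  shows "dilworth f X \<le> sum f P"
  unfolding dilworth_def
  using assms by (intro Min_le) (auto simp: finitely_many_partition_on)

lemma dilworth_attained:
  assumes "finite X"
  obtains P where "partition_on X P" "dilworth f X = sum f P"
proof -
  have "dilworth f X \<in> (\<lambda>P. sum f P) ` {P. partition_on X P}"
    unfolding dilworth_def using assms partition_on_singletons[of X]
    by (intro Min_in) (auto simp: finitely_many_partition_on)
  then show ?thesis using that by auto
qed

lemma dilworth_empty [simp]: "dilworth f {} = 0"
  by (simp add: dilworth_def partition_on_empty)

lemma dilworth_le_self: "finite X \<Longrightarrow> X \<noteq> {} \<Longrightarrow> dilworth f X \<le> f X"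
  using dilworth_le[OF _ partition_on_space, of X f] by simp

lemma partition_on_disjoint_Un:
  assumes P: "partition_on X P" and Q: "partition_on Y Q" and XY: "X \<inter> Y = {}"
  shows "partition_on (X \<union> Y) (P \<union> Q)" and "P \<inter> Q = {}"
proof -
  have C: "C \<subseteq> X" if "C \<in> P" for C using that partition_onD1[OF P] by auto
  have D: "D \<subseteq> Y" if "D \<in> Q" for D using that partition_onD1[OF Q] by auto
  have ne: "{} \<notin> P" "{} \<notin> Q" using partition_onD3[OF P] partition_onD3[OF Q] by auto
  \<comment> \<open>A common block would lie in \<open>X \<inter> Y\<close> and so be empty, but a
    partition has no empty block.\<close>
  show "P \<inter> Q = {}" using C D ne XY by (metis disjoint_iff inf.bounded_iff subset_empty)
  have "disjnt C D" if "C \<in> P" "D \<in> Q" for C D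
    using C[OF that(1)] D[OF that(2)] XY by (auto simp: disjnt_def)
  then have "disjnt C D" if "C \<in> P \<union> Q" "D \<in> P \<union> Q" "C \<noteq> D" for C D
    using that partition_onD2[OF P] partition_onD2[OF Q]
    by (metis UnE disjnt_sym pairwiseD)
  then show "partition_on (X \<union> Y) (P \<union> Q)"
    using partition_onD1[OF P] partition_onD1[OF Q] ne by (intro partition_onI) auto
qed

text \<open>Optimal partitions of two disjoint sets together partition the union.\<close>

lemma dilworth_disjoint_Un:
  assumes "finite X" "finite Y" "X \<inter> Y = {}"
  shows "dilworth f (X \<union> Y) \<le> dilworth f X + dilworth f Y"
proof -
  obtain P where P: "partition_on X P" "dilworth f X = sum f P"
    using dilworth_attained assms by metis
  obtain Q where Q: "partition_on Y Q" "dilworth f Y = sum f Q"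
    using dilworth_attained assms by metis
  have "dilworth f (X \<union> Y) \<le> sum f (P \<union> Q)"
    using partition_on_disjoint_Un[OF P(1) Q(1)] assms by (intro dilworth_le) auto
  also have "\<dots> = sum f P + sum f Q"
    using partition_on_disjoint_Un[OF P(1) Q(1)] assms finite_elements P Q
    by (intro sum.union_disjoint) blast+
  finally show ?thesis using P Q by simp
qed

text \<open>
  Absorbing into \<open>B\<close> the blocks that meet it, one at a time: each intermediate
  intersection is the original \<open>B \<inter> P\<close>, since the blocks are disjoint.
\<close>

lemma intersecting_submodular_absorb_blocks:
  assumes V: "finite V"
    and sub: "\<And>A B. A \<subseteq> V \<Longrightarrow> B \<subseteq> V \<Longrightarrow> A \<inter> B \<noteq> {} \<Longrightarrow> f (A \<inter> B) + f (A \<union> B) \<le> f A + f B"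
    and B: "B \<subseteq> V"
    and Q: "finite Q" "disjoint Q" "\<And>P. P \<in> Q \<Longrightarrow> P \<subseteq> V \<and> P \<inter> B \<noteq> {}"
  shows "f (B \<union> \<Union>Q) + dilworth f (B \<inter> \<Union>Q) \<le> f B + sum f Q"
  using Q
proof (induction Q rule: finite_induct)
  case (insert P Q)
  have "P \<inter> C = {}" if "C \<in> Q" for C
    by (rule disjointD[OF insert.prems(1)]) (use that insert.hyps(2) in auto)
  then have dj: "P \<inter> \<Union>Q = {}" by auto
  have QV: "\<Union>Q \<subseteq> V" "P \<subseteq> V" "P \<inter> B \<noteq> {}"
    using insert.prems by auto
  have fin: "finite (B \<inter> \<Union>Q)" "finite (B \<inter> P)"
    using V B finite_subset by (blast, blast)
  have "f (B \<union> \<Union>Q) + dilworth f (B \<inter> \<Union>Q) \<le> f B + sum f Q"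
    using insert.prems by (intro insert.IH) (auto simp: disjoint_def)
  moreover have "(B \<union> \<Union>Q) \<inter> P = B \<inter> P" using dj by auto
  then have "f (B \<inter> P) + f (B \<union> \<Union>Q \<union> P) \<le> f (B \<union> \<Union>Q) + f P"
    using sub[of "B \<union> \<Union>Q" P] B QV by auto
  moreover have "dilworth f (B \<inter> P) \<le> f (B \<inter> P)"
    using fin QV by (intro dilworth_le_self) auto
  moreover have "dilworth f (B \<inter> \<Union>Q \<union> B \<inter> P) \<le> dilworth f (B \<inter> \<Union>Q) + dilworth f (B \<inter> P)"
    using fin dj by (intro dilworth_disjoint_Un) auto
  moreover have "B \<inter> \<Union>Q \<union> B \<inter> P = B \<inter> \<Union>(insert P Q)" "B \<union> \<Union>Q \<union> P = B \<union> \<Union>(insert P Q)"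
    by auto
  ultimately show ?case using insert.hyps by simp
qed simp

text \<open>In an optimal partition of \<open>X\<close>, merge \<open>B\<close> with all blocks that
  meet it. The merged block and the untouched blocks partition \<open>X \<union> B\<close>;
  absorbing the blocks bounds the cost of the merger and leaves the truncation at
  \<open>X \<inter> B\<close>.\<close>

lemma dilworth_add_block:
  assumes V: "finite V"
    and sub: "\<And>A B. A \<subseteq> V \<Longrightarrow> B \<subseteq> V \<Longrightarrow> A \<inter> B \<noteq> {} \<Longrightarrow> f (A \<inter> B) + f (A \<union> B) \<le> f A + f B"
    and X: "X \<subseteq> V" and B: "B \<subseteq> V" "B \<noteq> {}"
  shows "dilworth f (X \<union> B) + dilworth f (X \<inter> B) \<le> dilworth f X + f B"
proof -
  have fin: "finite X" "finite B" using V X B finite_subset by auto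
  obtain P where P: "partition_on X P" "dilworth f X = sum f P"
    using dilworth_attained fin by metis
  note P' = partition_onD1[OF P(1)] partition_onD2[OF P(1)] partition_onD3[OF P(1)]
    finite_elements[OF fin(1) P(1)]
  define Q where "Q = {C \<in> P. C \<inter> B \<noteq> {}}"
  have Q: "Q \<subseteq> P" "finite Q" using P'(4) by (auto simp: Q_def)
  have "f (B \<union> \<Union>Q) + dilworth f (B \<inter> \<Union>Q) \<le> f B + sum f Q"
  proof (rule intersecting_submodular_absorb_blocks[OF V sub B(1) Q(2)])
    show "disjoint Q" using P'(2) Q(1) by (auto simp: disjoint_def)
    show "C \<subseteq> V \<and> C \<inter> B \<noteq> {}" if "C \<in> Q" for C
      using that P'(1) X by (auto simp: Q_def)
  qed
  moreover have "B \<inter> \<Union>Q = X \<inter> B"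
    using P'(1) by (auto simp: Q_def)
  moreover have "dilworth f (X \<union> B) \<le> f (B \<union> \<Union>Q) + sum f (P - Q)"
  proof -
    have dj: "(B \<union> \<Union>Q) \<inter> \<Union>(P - Q) = {}"
      using P'(2) by (auto simp: Q_def disjoint_def)
    have "partition_on (\<Union>(P - Q)) (P - Q)"
      using P' by (intro partition_onI) (auto simp: disjoint_def disjnt_def)
    moreover have "partition_on (B \<union> \<Union>Q) {B \<union> \<Union>Q}"
      using B by (intro partition_on_space) auto
    ultimately have "partition_on ((B \<union> \<Union>Q) \<union> \<Union>(P - Q)) ({B \<union> \<Union>Q} \<union> (P - Q))"
      "{B \<union> \<Union>Q} \<inter> (P - Q) = {}"
      using partition_on_disjoint_Un dj by blast+
    moreover have "(B \<union> \<Union>Q) \<union> \<Union>(P - Q) = X \<union> B"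
      using P'(1) Q(1) by auto
    ultimately have "dilworth f (X \<union> B) \<le> sum f ({B \<union> \<Union>Q} \<union> (P - Q))"
      using fin by (intro dilworth_le) auto
    also have "\<dots> = f (B \<union> \<Union>Q) + sum f (P - Q)"
      using \<open>{B \<union> \<Union>Q} \<inter> (P - Q) = {}\<close> P'(4) by simp
    finally show ?thesis .
  qed
  moreover have "sum f P = sum f Q + sum f (P - Q)"
    using P'(4) Q(1) by (metis add.commute sum.subset_diff)
  ultimately show ?thesis using P(2) by simp
qed

text \<open>The blocks of an optimal partition of \<open>Y\<close> are added to \<open>X\<close> in
  turn. By disjointness each new block meets the current set exactly in its trace on
  \<open>X\<close>, and disjoint subadditivity collects these traces into
  \<open>X \<inter> Y\<close>.\<close>

lemma dilworth_submodular:
  assumes V: "finite V"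
    and sub: "\<And>A B. A \<subseteq> V \<Longrightarrow> B \<subseteq> V \<Longrightarrow> A \<inter> B \<noteq> {} \<Longrightarrow> f (A \<inter> B) + f (A \<union> B) \<le> f A + f B"
    and X: "X \<subseteq> V" and Y: "Y \<subseteq> V"
  shows "dilworth f (X \<inter> Y) + dilworth f (X \<union> Y) \<le> dilworth f X + dilworth f Y"
proof -
  have fin: "finite A" if "A \<subseteq> V" for A using V that finite_subset by auto
  \<comment> \<open>Stated for any finite disjoint family of nonempty blocks so that the induction
    can pass to subfamilies; optimality enters only when it is applied.\<close>
  have blocks: "dilworth f (X \<inter> \<Union>Q) + dilworth f (X \<union> \<Union>Q) \<le> dilworth f X + sum f Q"
    if "finite Q" "disjoint Q" "\<And>C. C \<in> Q \<Longrightarrow> C \<subseteq> V \<and> C \<noteq> {}" for Q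
    using that
  proof (induction Q rule: finite_induct)
    case (insert B Q)
    have "B \<inter> C = {}" if "C \<in> Q" for C
      by (rule disjointD[OF insert.prems(1)]) (use that insert.hyps(2) in auto)
    then have dj: "B \<inter> \<Union>Q = {}" by auto
    have QV: "\<Union>Q \<subseteq> V" "B \<subseteq> V" "B \<noteq> {}"
      using insert.prems by auto
    have "dilworth f (X \<inter> \<Union>Q) + dilworth f (X \<union> \<Union>Q) \<le> dilworth f X + sum f Q"
      using insert.prems by (intro insert.IH) (auto simp: disjoint_def)
    moreover have "dilworth f (X \<union> \<Union>Q \<union> B) + dilworth f ((X \<union> \<Union>Q) \<inter> B)
        \<le> dilworth f (X \<union> \<Union>Q) + f B"
      using X QV by (intro dilworth_add_block[OF V sub]) auto
    moreover have "dilworth f (X \<inter> \<Union>Q \<union> X \<inter> B) \<le> dilworth f (X \<inter> \<Union>Q) + dilworth f (X \<inter> B)"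
      using dj X by (intro dilworth_disjoint_Un fin) auto
    moreover have "(X \<union> \<Union>Q) \<inter> B = X \<inter> B" "X \<union> \<Union>Q \<union> B = X \<union> \<Union>(insert B Q)"
      "X \<inter> \<Union>Q \<union> X \<inter> B = X \<inter> \<Union>(insert B Q)"
      using dj by auto
    ultimately show ?case using insert.hyps by simp
  qed simp
  obtain Q where Q: "partition_on Y Q" "dilworth f Y = sum f Q"
    using dilworth_attained fin Y by metis
  note Q' = partition_onD1[OF Q(1)] partition_onD2[OF Q(1)] partition_onD3[OF Q(1)]
    finite_elements[OF fin[OF Y] Q(1)]
  have "\<And>C. C \<in> Q \<Longrightarrow> C \<subseteq> V \<and> C \<noteq> {}" using Q' Y by auto
  from blocks[OF Q'(4,2) this] show ?thesis using Q(2) Q'(1) by simp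
qed

text \<open>Restrict an optimal partition of \<open>X\<close> to \<open>Y\<close>. Shrinking the
  blocks that meet \<open>Y\<close> lowers the sum by \<open>mono\<close>, and dropping the others
  lowers it by \<open>nonneg\<close>.\<close>

lemma dilworth_mono:
  assumes X: "finite X" and YX: "Y \<subseteq> X"
    and mono: "\<And>A B. A \<noteq> {} \<Longrightarrow> A \<subseteq> B \<Longrightarrow> B \<subseteq> X \<Longrightarrow> f A \<le> f B"
    and nonneg: "\<And>A. A \<noteq> {} \<Longrightarrow> A \<subseteq> X \<Longrightarrow> 0 \<le> f A"
  shows "dilworth f Y \<le> dilworth f X"
proof -
  obtain P where P: "partition_on X P" "dilworth f X = sum f P"
    using dilworth_attained X by metis
  note P' = partition_onD1[OF P(1)] partition_onD2[OF P(1)] partition_onD3[OF P(1)]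
    finite_elements[OF X P(1)]
  define Q where "Q = {C \<in> P. Y \<inter> C \<noteq> {}}"
  have Q: "Q \<subseteq> P" "finite Q" using P'(4) by (auto simp: Q_def)
  have img: "(\<inter>) Y ` P - {{}} = (\<inter>) Y ` Q" by (auto simp: Q_def)
  have "partition_on Y ((\<inter>) Y ` Q)"
    using partition_on_restrict[OF P(1), of Y] YX by (simp add: img Int_absorb2)
  then have "dilworth f Y \<le> sum f ((\<inter>) Y ` Q)"
    using X YX finite_subset by (intro dilworth_le) auto
  also have "\<dots> = (\<Sum>C\<in>Q. f (Y \<inter> C))"
  proof (rule sum.reindex_cong[OF _ refl refl])
    \<comment> \<open>Blocks with the same nonempty trace share a point, hence coincide.\<close>
    show "inj_on ((\<inter>) Y) Q"
    proof (rule inj_onI)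
      fix C D assume CD: "C \<in> Q" "D \<in> Q" "Y \<inter> C = Y \<inter> D"
      then have "C \<inter> D \<noteq> {}" by (auto simp: Q_def)
      then show "C = D" using P'(2) Q(1) CD by (auto simp: disjoint_def)
    qed
  qed
  also have "\<dots> \<le> sum f Q"
    using P'(1) Q(1) by (intro sum_mono mono) (auto simp: Q_def)
  also have "\<dots> \<le> sum f P"
    using P' Q(1) by (intro sum_mono2 nonneg) auto
  finally show ?thesis using P(2) by simp
qed

text \<open>Since \<open>sum r\<close> is additive over the blocks, bounds on the blocks add up for
  every partition.\<close>

lemma sum_le_dilworth:
  fixes r :: "'i \<Rightarrow> real"
  assumes X: "finite X" and le: "\<And>C. C \<subseteq> X \<Longrightarrow> C \<noteq> {} \<Longrightarrow> sum r C \<le> f C"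
  shows "sum r X \<le> dilworth f X"
proof -
  obtain P where P: "partition_on X P" "dilworth f X = sum f P"
    using dilworth_attained X by metis
  note P' = partition_onD1[OF P(1)] partition_onD2[OF P(1)] partition_onD3[OF P(1)]
  have "sum r X = (\<Sum>C\<in>P. sum r C)"
    unfolding P'(1)
  proof (rule sum.Union_disjoint[unfolded comp_apply])
    have "finite C" if "C \<in> P" for C
      by (rule finite_subset[OF _ X]) (use that P'(1) in auto)
    then show "\<forall>C\<in>P. finite C" ..
    show "\<forall>C\<in>P. \<forall>D\<in>P. C \<noteq> D \<longrightarrow> C \<inter> D = {}" using P'(2) by (simp add: disjoint_def)
  qed
  also have "\<dots> \<le> sum f P"
    using P' by (intro sum_mono le) auto
  finally show ?thesis using P(2) by simp
qed

section \<open>The rate region\<close>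

lemma polymatroid_rank_mono:
  "polymatroid_rank V f \<Longrightarrow> Y \<subseteq> X \<Longrightarrow> X \<subseteq> V \<Longrightarrow> f Y \<le> f X"
  by (simp add: polymatroid_rank_def)

lemma R_CO_iff:
  "r \<in> R_CO V H \<longleftrightarrow> r \<in> extensional V \<and> (\<forall>X. X \<subset> V \<longrightarrow> H V - H (V - X) \<le> sum r X)"
proof -
  have "X \<union> (V - X) = V" if "X \<subset> V" for X using that by auto
  then show ?thesis by (auto simp: R_CO_def cond_ent_def)
qed

text \<open>The constraint at \<open>{i}\<close> has a nonnegative left side because
  \<open>H\<close> is monotone. It is in force because \<open>card V > 1\<close> makes
  \<open>{i}\<close> a proper subset.\<close>

lemma R_CO_nonneg:
  assumes "polymatroid_rank V H" "r \<in> R_CO V H" "card V > 1" "i \<in> V"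
  shows "0 \<le> r i"
proof -
  have "{i} \<subset> V" using assms(3,4) by auto
  then have "H V - H (V - {i}) \<le> sum r {i}" using assms(2) unfolding R_CO_iff by blast
  moreover have "H (V - {i}) \<le> H V" by (rule polymatroid_rank_mono[OF assms(1)]) auto
  ultimately show ?thesis by simp
qed

section \<open>Existence of rate vectors with a prescribed sum\<close>

text \<open>Tychonoff's theorem on the full function space, with the coordinates outside
  \<open>I\<close> pinned to the compact set \<open>{undefined}\<close>.\<close>

lemma compact_PiE_euclidean:
  fixes S :: "'i \<Rightarrow> 'b::topological_space set"
  assumes "\<And>i. i \<in> I \<Longrightarrow> compact (S i)"
  shows "compact (PiE I S)"
proof -
  define T where "T = (\<lambda>i. if i \<in> I then S i else {undefined})"
  have "PiE I S = PiE UNIV T"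
  proof (rule set_eqI)
    fix f
    have "f i \<in> T i \<longleftrightarrow> (i \<in> I \<longrightarrow> f i \<in> S i) \<and> (i \<notin> I \<longrightarrow> f i = undefined)" for i
      by (simp add: T_def)
    then show "f \<in> PiE I S \<longleftrightarrow> f \<in> PiE UNIV T"
      unfolding PiE_iff extensional_def by blast
  qed
  moreover have "compact (T i)" for i
    using assms by (simp add: T_def)
  then have "compactin (product_topology (\<lambda>_. euclidean) UNIV) (PiE UNIV T)"
    by (simp add: compactin_PiE)
  then have "compactin euclidean (PiE UNIV T)"
    by (simp only: euclidean_product_topology)
  ultimately show ?thesis
    by (simp only: compactin_euclidean_iff)
qed

text \<open>This makes the \<open>LEAST\<close> in \<open>R_ACO\<close> a genuine minimum. The
  region is unbounded, but capping the sum at that of a feasible vector leaves a compact set, as the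
  coordinates are nonnegative.\<close>

lemma R_CO_attains_min:
  fixes H :: "'i set \<Rightarrow> real"
  assumes V: "finite V" "card V > 1" and H: "polymatroid_rank V H"
  obtains r where "r \<in> R_CO V H" "\<And>s. s \<in> R_CO V H \<Longrightarrow> sum r V \<le> sum s V"
proof -
  \<comment> \<open>Feasible because a single coordinate already reaches \<open>H V\<close>, which
    dominates every constraint of a nonempty set; the constraint of the empty set reads 0 <=
    0.\<close>
  define r0 :: "'i \<Rightarrow> real" where "r0 = (\<lambda>i\<in>V. H V)"
  define K where "K = sum r0 V"
  have Hnn: "0 \<le> H X" if "X \<subseteq> V" for X
    using H that unfolding polymatroid_rank_def by (metis empty_subsetI)
  have r0: "r0 \<in> R_CO V H"
    unfolding R_CO_iff
  proof (intro conjI allI impI)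
    show "r0 \<in> extensional V" by (simp add: r0_def)
    fix X assume X: "X \<subset> V"
    show "H V - H (V - X) \<le> sum r0 X"
    proof (cases "X = {}")
      case False
      have "finite X" using X V finite_subset by blast
      then have "1 \<le> card X" using False by (simp add: Suc_leI card_gt_0_iff)
      then have "1 * H V \<le> real (card X) * H V"
        using Hnn[of V] by (intro mult_right_mono) auto
      also have "\<dots> = sum r0 X"
        using X by (subst sum.cong[OF refl, of X r0 "\<lambda>_. H V"]) (auto simp: r0_def)
      finally show ?thesis using Hnn[of "V - X"] by auto
    qed auto
  qed
  \<comment> \<open>The box is implied by the other conditions, since a nonnegative coordinate is at
    most the sum; it is listed to exhibit compactness.\<close>
  define S where "S = PiE V (\<lambda>_. {0..K}) \<inter>
    (\<Inter>X\<in>{X. X \<subset> V}. {r. H V - H (V - X) \<le> sum r X}) \<inter> {r. sum r V \<le> K}"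
  have "compact S"
    unfolding S_def
    by (intro compact_Int_closed compact_PiE_euclidean closed_INT ballI closed_Collect_le
          continuous_on_sum continuous_on_product_coordinates continuous_on_const) auto
  have S: "r \<in> S \<longleftrightarrow> r \<in> R_CO V H \<and> sum r V \<le> K" for r
  proof
    assume r: "r \<in> R_CO V H \<and> sum r V \<le> K"
    have "r i \<in> {0..K}" if "i \<in> V" for i
    proof -
      have nn: "\<And>j. j \<in> V \<Longrightarrow> 0 \<le> r j" using R_CO_nonneg[OF H _ V(2)] r by blast
      moreover have "r i \<le> sum r V" using nn that V by (intro member_le_sum) auto
      ultimately show ?thesis using that r by auto
    qed
    then show "r \<in> S" using r by (auto simp: S_def R_CO_iff PiE_def)
  qed (auto simp: S_def R_CO_iff PiE_def)
  have "continuous_on S (\<lambda>r. sum r V)"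
    by (intro continuous_on_sum continuous_on_subset[OF continuous_on_product_coordinates]) simp
  moreover have "S \<noteq> {}" using r0 S[of r0] by (auto simp: K_def)
  ultimately obtain r where r: "r \<in> S" "\<And>s. s \<in> S \<Longrightarrow> sum r V \<le> sum s V"
    using continuous_attains_inf[OF \<open>compact S\<close>, of "\<lambda>r. sum r V"] by auto
  show ?thesis
  proof (rule that)
    show "r \<in> R_CO V H" using r S by auto
    \<comment> \<open>A vector outside \<open>S\<close> has a sum above \<open>K\<close>, and
      \<open>K\<close> bounds the sum of \<open>r\<close>.\<close>
    show "sum r V \<le> sum s V" if "s \<in> R_CO V H" for s
      using r S[of r] S[of s] that by (cases "sum s V \<le> K") auto
  qed
qed

text \<open>All constraints are lower bounds, so the surplus over the minimum may be put on a single
  coordinate.\<close>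

lemma R_CO_rate_exists:
  assumes V: "finite V" "card V > 1" and H: "polymatroid_rank V H" and \<alpha>: "R_ACO V H \<le> \<alpha>"
  obtains r where "r \<in> R_CO V H" "sum r V = \<alpha>"
proof -
  obtain r where r: "r \<in> R_CO V H" "\<And>s. s \<in> R_CO V H \<Longrightarrow> sum r V \<le> sum s V"
    using R_CO_attains_min[OF V H] by metis
  have "R_ACO V H = sum r V"
    unfolding R_ACO_def using r by (intro Least_equality) auto
  then have d: "0 \<le> \<alpha> - sum r V" using \<alpha> by simp
  obtain v where v: "v \<in> V" using V(2) by fastforce
  define s where "s = r(v := r v + (\<alpha> - sum r V))"
  have s: "sum s X = sum r X + (if v \<in> X then \<alpha> - sum r V else 0)" if "X \<subseteq> V" for X
  proof -
    have "finite X" using that V finite_subset by auto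
    have "sum s X = (\<Sum>i\<in>X. r i + (if i = v then \<alpha> - sum r V else 0))"
      by (intro sum.cong) (auto simp: s_def)
    then show ?thesis using \<open>finite X\<close> by (simp add: sum.distrib)
  qed
  show ?thesis
  proof (rule that)
    show "sum s V = \<alpha>" using s[of V] v by simp
    have "s \<in> extensional V" using r(1) v by (auto simp: R_CO_iff s_def extensional_def)
    moreover have "H V - H (V - X) \<le> sum s X" if "X \<subset> V" for X
    proof -
      have "H V - H (V - X) \<le> sum r X" using r(1) that unfolding R_CO_iff by blast
      also have "\<dots> \<le> sum s X" using d s[of X] that by auto
      finally show ?thesis .
    qed
    ultimately show "s \<in> R_CO V H" by (auto simp: R_CO_iff)
  qed
qed

section \<open>Base polyhedra and the truncated function\<close>

text \<open>The exception at \<open>{}\<close> comes from the value \<alpha> of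
  \<open>f_rate\<close> at its complement \<open>V\<close>. Elsewhere \<open>f_sharp\<close> is
  entropy shifted by a constant.\<close>

lemma f_sharp_eq:
  assumes "X \<subseteq> V" "V \<noteq> {}"
  shows "f_sharp V H \<alpha> X = (if X = {} then 0 else \<alpha> - H V + H X)"
proof (cases "X = {}")
  case False
  then have "V - X \<noteq> V" "V - X \<union> (V - (V - X)) = V" "V - (V - X) = X" using assms by auto
  then show ?thesis using False by (simp add: f_sharp_def f_rate_def cond_ent_def)
qed (simp add: f_sharp_def f_rate_def)

text \<open>Once \<open>sum r V\<close> is fixed, an upper bound on \<open>X\<close> is a lower
  bound on \<open>V - X\<close>; nonempty sets correspond to proper subsets, and the bound at
  \<open>{}\<close> is trivial.\<close>

lemma base_polyhedron_f_sharp: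
  assumes V: "finite V" "V \<noteq> {}"
  shows "base_polyhedron V (f_sharp V H \<alpha>) = {r \<in> R_CO V H. sum r V = \<alpha>}"
proof (rule set_eqI)
  fix r :: "'a \<Rightarrow> real"
  have compl: "sum r V = sum r X + sum r (V - X)" if "X \<subseteq> V" for X
    using V that by (metis add.commute sum.subset_diff)
  have "(\<forall>X. X \<subseteq> V \<longrightarrow> sum r X \<le> f_sharp V H \<alpha> X)
      \<longleftrightarrow> (\<forall>X. X \<subset> V \<longrightarrow> H V - H (V - X) \<le> sum r X)" if "sum r V = \<alpha>"
  proof (intro iffI allI impI)
    fix X assume *: "\<forall>X. X \<subseteq> V \<longrightarrow> sum r X \<le> f_sharp V H \<alpha> X" and X: "X \<subset> V"
    have "sum r (V - X) \<le> f_sharp V H \<alpha> (V - X)" using * by auto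
    moreover have "f_sharp V H \<alpha> (V - X) = \<alpha> - H V + H (V - X)"
      using X V by (subst f_sharp_eq) auto
    ultimately show "H V - H (V - X) \<le> sum r X"
      using compl[of X] X that by auto
  next
    fix X assume *: "\<forall>X. X \<subset> V \<longrightarrow> H V - H (V - X) \<le> sum r X" and X: "X \<subseteq> V"
    show "sum r X \<le> f_sharp V H \<alpha> X"
    proof (cases "X = {}")
      case False
      then have "V - X \<subset> V" "V - (V - X) = X" using X by auto
      then have "H V - H X \<le> sum r (V - X)" using * by metis
      then show ?thesis using False compl[OF X] that X V by (simp add: f_sharp_eq)
    qed (use V in \<open>simp add: f_sharp_eq\<close>)
  qed
  moreover have "f_sharp V H \<alpha> V = \<alpha>" using V by (simp add: f_sharp_eq)
  ultimately show "r \<in> base_polyhedron V (f_sharp V H \<alpha>) \<longleftrightarrow> r \<in> {r \<in> R_CO V H. sum r V = \<alpha>}"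
    by (auto simp: base_polyhedron_def sub_polyhedron_def R_CO_iff)
qed

text \<open>Truncation lowers \<open>f\<close>, yet stays above every additive function below
  \<open>f\<close>. The condition on \<open>f {}\<close> matches the value 0 of the truncation
  there.\<close>

lemma sub_polyhedron_dilworth:
  assumes V: "finite V" and f: "f {} = 0"
  shows "sub_polyhedron V (dilworth f) = sub_polyhedron V f"
proof -
  have fin: "finite X" if "X \<subseteq> V" for X using V that finite_subset by auto
  have "dilworth f X \<le> f X" if "X \<subseteq> V" for X
    using dilworth_le_self[OF fin[OF that], of f] f by (cases "X = {}") auto
  moreover have "sum r X \<le> dilworth f X" if "\<forall>Y. Y \<subseteq> V \<longrightarrow> sum r Y \<le> f Y" "X \<subseteq> V" for r X
    using that fin by (intro sum_le_dilworth) auto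
  ultimately show ?thesis
    unfolding sub_polyhedron_def by (blast intro: order_trans)
qed

text \<open>The vector \<open>r\<close> serves to show that \<open>f_sharp\<close> is nonnegative,
  as it lies between 0 and \<open>f_sharp\<close>; monotonicity of the truncation rests on
  this.\<close>

lemma polymatroid_rank_dilworth_f_sharp:
  assumes V: "finite V" "card V > 1" and H: "polymatroid_rank V H"
    and r: "r \<in> base_polyhedron V (f_sharp V H \<alpha>)"
  shows "polymatroid_rank V (dilworth (f_sharp V H \<alpha>))"
proof -
  have ne: "V \<noteq> {}" using V by auto
  have rCO: "r \<in> R_CO V H" using r base_polyhedron_f_sharp[OF V(1) ne] by auto
  have nonneg: "0 \<le> f_sharp V H \<alpha> X" if "X \<subseteq> V" for X
  proof -
    have "0 \<le> sum r X" using R_CO_nonneg[OF H rCO V(2)] that by (intro sum_nonneg) auto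
    also have "\<dots> \<le> f_sharp V H \<alpha> X"
      using r that by (auto simp: base_polyhedron_def sub_polyhedron_def)
    finally show ?thesis .
  qed
  show ?thesis
    unfolding polymatroid_rank_def
  proof (intro conjI allI impI)
    fix X Y assume XY: "Y \<subseteq> X \<and> X \<subseteq> V"
    show "dilworth (f_sharp V H \<alpha>) Y \<le> dilworth (f_sharp V H \<alpha>) X"
    proof (rule dilworth_mono)
      fix A B assume AB: "A \<noteq> {}" "A \<subseteq> B" "B \<subseteq> X"
      then have "H A \<le> H B" using polymatroid_rank_mono[OF H, of A B] XY by auto
      moreover have "A \<subseteq> V" "B \<subseteq> V" "B \<noteq> {}" using AB XY by auto
      ultimately show "f_sharp V H \<alpha> A \<le> f_sharp V H \<alpha> B"
        using AB ne by (simp add: f_sharp_eq)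
    qed (use XY V nonneg finite_subset in auto)
  next
    fix X Y assume XY: "X \<subseteq> V \<and> Y \<subseteq> V"
    have "f_sharp V H \<alpha> (A \<inter> B) + f_sharp V H \<alpha> (A \<union> B) \<le> f_sharp V H \<alpha> A + f_sharp V H \<alpha> B"
      if AB: "A \<subseteq> V" "B \<subseteq> V" "A \<inter> B \<noteq> {}" for A B
    proof -
      have "H (A \<inter> B) + H (A \<union> B) \<le> H A + H B"
        using H AB by (simp add: polymatroid_rank_def)
      \<comment> \<open>All four sets are nonempty, so the constant \<open>\<alpha> - H V\<close>
        occurs twice on each side and cancels.\<close>
      moreover have "A \<inter> B \<subseteq> V" "A \<union> B \<subseteq> V" "A \<noteq> {}" "B \<noteq> {}" "A \<union> B \<noteq> {}" using AB by auto
      ultimately show ?thesis using AB ne by (simp add: f_sharp_eq)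
    qed
    then show "dilworth (f_sharp V H \<alpha>) X + dilworth (f_sharp V H \<alpha>) Y
        \<ge> dilworth (f_sharp V H \<alpha>) (X \<inter> Y) + dilworth (f_sharp V H \<alpha>) (X \<union> Y)"
      using dilworth_submodular[OF V(1), of "f_sharp V H \<alpha>" X Y] XY by auto
  qed simp
qed

text \<open>The result for an arbitrary polymatroid rank function; probability enters only through
  \<open>H\<close>.\<close>

lemma dilworth_f_sharp_base_polyhedron:
  assumes V: "finite V" "card V > 1" and H: "polymatroid_rank V H" and \<alpha>: "\<alpha> \<ge> R_ACO V H"
  shows "polymatroid_rank V (dilworth (f_sharp V H \<alpha>)) \<and>
    base_polyhedron V (dilworth (f_sharp V H \<alpha>)) = base_polyhedron V (f_sharp V H \<alpha>) \<and>
    base_polyhedron V (f_sharp V H \<alpha>) = {r \<in> R_CO V H. sum r V = \<alpha>} \<and>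
    {r \<in> R_CO V H. sum r V = \<alpha>} \<noteq> {}"
proof -
  let ?f = "f_sharp V H \<alpha>"
  have ne: "V \<noteq> {}" using V by auto
  note base = base_polyhedron_f_sharp[OF V(1) ne, of H \<alpha>]
  obtain r where r: "r \<in> R_CO V H" "sum r V = \<alpha>"
    using R_CO_rate_exists[OF V H \<alpha>] by metis
  then have rb: "r \<in> base_polyhedron V ?f" using base by auto
  have fV: "?f V = \<alpha>" "?f {} = 0" using ne by (simp_all add: f_sharp_eq)
  have sub: "sub_polyhedron V (dilworth ?f) = sub_polyhedron V ?f"
    using V(1) fV(2) by (rule sub_polyhedron_dilworth)
  \<comment> \<open>The vector \<open>r\<close> certifies that truncation does not lower the value
    at \<open>V\<close>. Without this, the two base polyhedra would be cut out at different
    sums.\<close>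
  have "r \<in> sub_polyhedron V (dilworth ?f)"
    using rb by (auto simp: sub base_polyhedron_def)
  then have "\<alpha> \<le> dilworth ?f V" using r(2) by (auto simp: sub_polyhedron_def)
  then have "dilworth ?f V = ?f V"
    using dilworth_le_self[OF V(1) ne, of ?f] fV(1) by simp
  then have "base_polyhedron V (dilworth ?f) = base_polyhedron V ?f"
    by (simp add: base_polyhedron_def sub)
  then show ?thesis
    using polymatroid_rank_dilworth_f_sharp[OF V H rb] base r by blast
qed

theorem mainTheorem2:
  fixes V :: "'i set"
    and M :: "'a measure"
    and b :: real
    and Z :: "'i \<Rightarrow> 'a \<Rightarrow> 'b"
    and H :: "'i set \<Rightarrow> real"
    and \<alpha> :: real
  assumes "finite V" and "card V > 1"
    and "information_space M b"
    and "\<And>i. i \<in> V \<Longrightarrow> discrete_rv M (Z i)"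
    and "\<And>X. X \<subseteq> V \<Longrightarrow> information_space.has_finite_entropy M b (joint Z X)"
    and "H = information_space.joint_entropy M b Z"
    and "\<alpha> \<ge> R_ACO V H"
  shows "polymatroid_rank V (dilworth (f_sharp V H \<alpha>)) \<and>
    base_polyhedron V (dilworth (f_sharp V H \<alpha>)) = base_polyhedron V (f_sharp V H \<alpha>) \<and>
    base_polyhedron V (f_sharp V H \<alpha>) = {r \<in> R_CO V H. sum r V = \<alpha>} \<and>
    {r \<in> R_CO V H. sum r V = \<alpha>} \<noteq> {}"
proof (rule dilworth_f_sharp_base_polyhedron[OF assms(1,2) _ assms(7)])
  show "polymatroid_rank V H"
    unfolding assms(6)
    by (rule information_space.polymatroid_rank_joint_entropy[OF assms(3) assms(5)])
qed

end
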